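(* Let $\mathbb{G}$ be a stratified group with $N\ge 3$ the dimension of its first stratum, let $\Omega\subset\mathbb{G}$ be an open set, and let $x_0\in\Omega$. Then $$\int_\Omega e^{-\frac{|(xx_0^{-1})'|^2}{4\lambda}}\left(\frac{(N-2)^2}{4|x'|^2}-\frac{N}{4\lambda}+\frac{|(xx_0^{-1})'|^2}{16\lambda^2}\right)|u|^2\,dx\ \le\ \int_\Omega e^{-\frac{|(xx_0^{-1})'|^2}{4\lambda}}|\nabla_{\mathbb{G}}u|^2\,dx$$ for all $u\in C^1(\Omega)$ and for each $\lambda>0$.
   Context: A stratified group (homogeneous Carnot group) $\mathbb{G}=(\mathbb{R}^d,\circ,\delta_\lambda)$ of step $r$ is a Lie group structure on $\mathbb{R}^d$, with points written $x=(x',x^{(2)},\ldots,x^{(r)})$, $x'=(x'_1,\ldots,x'_N)\in\mathbb{R}^N$ (the first stratum coordinates), $x^{(l)}=(x^{(l)}_1,\ldots,x^{(l)}_{N_l})\in\mathbb{R}^{N_l}$, such that the dilations $\delta_s(x)=(sx',s^2x^{(2)},\ldots,s^rx^{(r)})$, $s>0$, are group automorphisms, and such that the left-invariant vector fields $X_1,\ldots,X_N$ with $X_k(0)=\partial/\partial x'_k|_0$ (the Jacobian generators of the first stratum) generate, together with their iterated commutators, the whole Lie algebra. Explicitly, $X_k=\frac{\partial}{\partial x'_k}+\sum_{l=2}^{r}\sum_{m=1}^{N_l}a^{(l)}_{k,m}(x',\ldots,x^{(l-1)})\frac{\partial}{\partial x^{(l)}_m}$. The horizontal gradient is $\nabla_{\mathbb{G}}=(X_1,\ldots,X_N)$.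 One has $(xx_0^{-1})'=x'-x_0'$, and $|\cdot|$ on $\mathbb{R}^N$ is the Euclidean norm. $dx$ is Lebesgue measure on $\mathbb{R}^d$, which is the Haar measure of $\mathbb{G}$. $C^1(\Omega)$ denotes the continuously differentiable functions on $\Omega$.
   Formalization: The inequality is proved for u in C^1(Ω) with compact support in Ω; for all u in C^1(Ω) it is false: with G = R^3, Ω the ball of radius 1/2 about x_0 = e_1, u = 1 and λ = 100, the right side is 0 and the left side is positive. *)

theory Defs
  imports "HOL-Analysis.Analysis"
begin

text \<open>\<open>Ck_on k f S\<close>: on the open set \<open>S\<close>, \<open>f\<close> has continuous derivatives up to order \<open>k\<close>
  (on a finite-dimensional domain, continuity of all directional derivatives of a
  differentiable function is continuity of the derivative).\<close>

fun Ck_on :: "nat \<Rightarrow> ('a::euclidean_space \<Rightarrow> 'b::real_normed_vector) \<Rightarrow> 'a set \<Rightarrow> bool" where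
  "Ck_on 0 f S \<longleftrightarrow> continuous_on S f"
| "Ck_on (Suc k) f S \<longleftrightarrow>
     (\<forall>x\<in>S. f differentiable at x) \<and> (\<forall>v. Ck_on k (\<lambda>x. frechet_derivative f (at x) v) S)"

definition smooth_on :: "('a::euclidean_space \<Rightarrow> 'b::real_normed_vector) \<Rightarrow> 'a set \<Rightarrow> bool" where
  "smooth_on f S \<longleftrightarrow> (\<forall>k. Ck_on k f S)"

definition vf_apply :: "('a::euclidean_space \<Rightarrow> 'a) \<Rightarrow> ('a \<Rightarrow> 'b::real_normed_vector) \<Rightarrow> 'a \<Rightarrow> 'b" where
  "vf_apply V u x = frechet_derivative u (at x) (V x)"

definition vf_bracket :: "('a::euclidean_space \<Rightarrow> 'a) \<Rightarrow> ('a \<Rightarrow> 'a) \<Rightarrow> 'a \<Rightarrow> 'a" where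
  "vf_bracket V W x = vf_apply V W x - vf_apply W V x"

inductive_set lie_generated :: "('a::euclidean_space \<Rightarrow> 'a) set \<Rightarrow> ('a \<Rightarrow> 'a) set"
  for S :: "('a \<Rightarrow> 'a) set" where
  base: "V \<in> S \<Longrightarrow> V \<in> lie_generated S"
| zero: "(\<lambda>x. 0) \<in> lie_generated S"
| add: "V \<in> lie_generated S \<Longrightarrow> W \<in> lie_generated S \<Longrightarrow> (\<lambda>x. V x + W x) \<in> lie_generated S"
| scale: "V \<in> lie_generated S \<Longrightarrow> (\<lambda>x. c *\<^sub>R V x) \<in> lie_generated S"
| bracket: "V \<in> lie_generated S \<Longrightarrow> W \<in> lie_generated S \<Longrightarrow> vf_bracket V W \<in> lie_generated S"

definition left_invariant :: "('a::euclidean_space \<Rightarrow> 'a \<Rightarrow> 'a) \<Rightarrow> ('a \<Rightarrow> 'a) \<Rightarrow> bool" where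
  "left_invariant mul V \<longleftrightarrow>
     smooth_on V UNIV \<and> (\<forall>x y. V (mul x y) = frechet_derivative (mul x) (at y) (V y))"

text \<open>The strata of \<open>\<real>\<^sup>d\<close> (\<open>d = CARD('n)\<close>) are encoded by a map \<open>\<sigma>\<close> sending each coordinate
  index to the number of its stratum, so \<open>x\<^sup>(\<^sup>l\<^sup>)\<close> consists of the \<open>x $ i\<close> with \<open>\<sigma> i = l\<close>.\<close>

definition stratum :: "('n \<Rightarrow> nat) \<Rightarrow> nat \<Rightarrow> 'n set" where
  "stratum \<sigma> l = {i. \<sigma> i = l}"

definition dilation :: "('n::finite \<Rightarrow> nat) \<Rightarrow> real \<Rightarrow> real ^ 'n \<Rightarrow> real ^ 'n" where
  "dilation \<sigma> s x = (\<chi> i. s ^ \<sigma> i * x $ i)"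

text \<open>The left-invariant vector field equal to \<open>\<partial>/\<partial>x\<^sub>k\<close> at the neutral element 0: its value at
  \<open>x\<close> is the \<open>k\<close>-th column of the Jacobian matrix at 0 of left translation by \<open>x\<close>.\<close>

definition jacobian_generator ::
  "(real ^ 'n \<Rightarrow> real ^ 'n \<Rightarrow> real ^ 'n) \<Rightarrow> 'n::finite \<Rightarrow> real ^ 'n \<Rightarrow> real ^ 'n" where
  "jacobian_generator mul k x = frechet_derivative (mul x) (at 0) (axis k 1)"

text \<open>That the neutral element is 0 is no restriction: it is fixed by all dilations.\<close>

locale stratified_group = group mul "0 :: real ^ 'n::finite" ginv
  for mul :: "real ^ 'n \<Rightarrow> real ^ 'n \<Rightarrow> real ^ 'n" and ginv :: "real ^ 'n \<Rightarrow> real ^ 'n" +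
  fixes \<sigma> :: "'n \<Rightarrow> nat" and r :: nat
  assumes strata: "range \<sigma> = {1..r}"
    and smooth_mul: "smooth_on (\<lambda>(x, y). mul x y) UNIV"
    and smooth_inv: "smooth_on ginv UNIV"
    and dilation_mul:
      "s > 0 \<Longrightarrow> dilation \<sigma> s (mul x y) = mul (dilation \<sigma> s x) (dilation \<sigma> s y)"
    and generated:
      "lie_generated (jacobian_generator mul ` stratum \<sigma> 1) = {V. left_invariant mul V}"

text \<open>The Euclidean norm \<open>|x'|\<close> of the first-stratum coordinates, and \<open>|\<nabla>\<^sub>G u|\<close>.\<close>

definition norm1 :: "('n::finite \<Rightarrow> nat) \<Rightarrow> real ^ 'n \<Rightarrow> real" where
  "norm1 \<sigma> x = L2_set (\<lambda>i. x $ i) (stratum \<sigma> 1)"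

definition norm_hgrad ::
  "(real ^ 'n \<Rightarrow> real ^ 'n \<Rightarrow> real ^ 'n) \<Rightarrow> ('n::finite \<Rightarrow> nat) \<Rightarrow>
    (real ^ 'n \<Rightarrow> 'b::real_normed_vector) \<Rightarrow> real ^ 'n \<Rightarrow> real" where
  "norm_hgrad mul \<sigma> u x =
     L2_set (\<lambda>k. norm (vf_apply (jacobian_generator mul k) u x)) (stratum \<sigma> 1)"

end

theory Submission
  imports Defs
begin

text \<open>
  The inequality is an expanded square. Write \<open>w\<close> for the Gaussian weight, \<open>\<rho>(x) = |x'|\<close> and
  \<open>m = (N - 2) / 2\<close>. For real functions \<open>c\<^sub>k\<close>, one for each generator \<open>X\<^sub>k\<close>, expand
  \<open>0 \<le> \<integral> w \<Sum>\<^sub>k |X\<^sub>k u + c\<^sub>k u|\<^sup>2\<close>. The cross term is \<open>\<integral> w c\<^sub>k X\<^sub>k |u|\<^sup>2\<close>, and integration by parts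
  turns it into \<open>- \<integral> X\<^sub>k (w c\<^sub>k) |u|\<^sup>2\<close>, whence
  \<open>\<integral> (\<Sum>\<^sub>k (X\<^sub>k (w c\<^sub>k) - w c\<^sub>k\<^sup>2)) |u|\<^sup>2 \<le> \<integral> w \<Sum>\<^sub>k |X\<^sub>k u|\<^sup>2\<close>
  (\<open>weighted_inequality_completing_squares\<close>). With
  \<open>c\<^sub>k = m x'\<^sub>k / \<rho>\<^sup>2 - (x' - x\<^sub>0')\<^sub>k / (4 \<lambda>)\<close> the bracket on the left is \<open>w\<close> times the
  potential of the theorem: the first summand is the extremal field of Hardy's inequality, and the second one,
  which is half the logarithmic gradient of \<open>w\<close>, cancels the mixed terms.

  Two facts on the group make this work, and both come from the dilations. First,
  \<open>\<partial>\<^sub>i (X\<^sub>k)\<^sub>i = 0\<close> for every coordinate \<open>i\<close> (\<open>jacobian_generator_own_partial_eq_zero\<close>): this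
  function is homogeneous of degree \<open>-1\<close> and continuous at \<open>0\<close>. Therefore \<open>X\<^sub>k f\<close> is a sum of
  coordinate derivatives \<open>\<partial>\<^sub>i ((X\<^sub>k)\<^sub>i f)\<close> and has integral \<open>0\<close> for \<open>C\<^sup>1\<close> functions \<open>f\<close> of compact support.
  Second, the group law is addition on the first stratum (\<open>mul_first_stratum\<close>), so that
  \<open>(x x\<^sub>0\<inverse>)' = x' - x\<^sub>0'\<close>, and \<open>X\<^sub>k\<close> acts as \<open>\<partial> / \<partial>x'\<^sub>k\<close> on functions of \<open>x'\<close>.

  The field \<open>c\<close> is singular where \<open>x' = 0\<close>. Replacing \<open>\<rho>\<^sup>2\<close> by \<open>\<rho>\<^sup>2 + \<epsilon>\<close> only leaves an error of
  favourable sign, namely \<open>(m\<^sup>2 + 2 m) \<epsilon> / (\<rho>\<^sup>2 + \<epsilon>)\<^sup>2 \<ge> 0\<close> (\<open>gaussian_hardy_regularised\<close>), and monotone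
  convergence lets \<open>\<epsilon>\<close> tend to \<open>0\<close> (\<open>gaussian_hardy\<close>).
\<close>

section \<open>Integration by parts for compactly supported functions\<close>

lemma integrable_continuous_compact_support:
  fixes g :: "'a::euclidean_space \<Rightarrow> real"
  assumes "continuous_on UNIV g" and "compact K" and "\<And>x. x \<notin> K \<Longrightarrow> g x = 0"
  shows "integrable lborel g"
proof -
  have "integrable lborel (\<lambda>x. indicator K x *\<^sub>R g x)"
    using assms by (intro borel_integrable_compact) (auto intro: continuous_on_subset)
  also have "(\<lambda>x. indicator K x *\<^sub>R g x) = g"
    using assms(3) by (force simp: indicator_def)
  finally show ?thesis .
qed

lemma has_derivative_eq_zero_outside_support:
  fixes g :: "'a::real_normed_vector \<Rightarrow> 'b::real_normed_vector"
  assumes "(g has_derivative g') (at x)" and "closed K" and "\<And>y. y \<notin> K \<Longrightarrow> g y = 0" and "x \<notin> K"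
  shows "g' = (\<lambda>v. 0)"
proof -
  have "(g has_derivative (\<lambda>v. 0)) (at x)"
    using assms(2-4)
    by (intro has_derivative_transform_within_open[OF has_derivative_const[of 0 "at x"], of "- K"]) auto
  then show ?thesis
    using assms(1) has_derivative_unique by blast
qed

text \<open>Translation invariance makes every difference quotient
  \<open>(g (x + t v) - g x) / t\<close> integrate to \<open>0\<close>; these quotients are uniformly bounded and vanish
  outside a bounded set, so dominated convergence applies as \<open>t\<close> tends to \<open>0\<close>.\<close>

lemma integral_directional_derivative_eq_zero:
  fixes g :: "'a::euclidean_space \<Rightarrow> real"
  assumes der: "\<And>x. (g has_derivative g' x) (at x)"
    and cont: "continuous_on UNIV (\<lambda>x. g' x v)"
    and K: "compact K" and supp: "\<And>x. x \<notin> K \<Longrightarrow> g x = 0"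
  shows "integrable lborel (\<lambda>x. g' x v)" and "(LINT x|lborel. g' x v) = 0"
proof -
  have zero: "g' x v = 0" if "x \<notin> K" for x
    using has_derivative_eq_zero_outside_support[OF der compact_imp_closed[OF K] supp that] by metis
  show "integrable lborel (\<lambda>x. g' x v)"
    using integrable_continuous_compact_support[OF cont K zero] .
  have gcont: "continuous_on UNIV g"
    by (meson der continuous_at_imp_continuous_on has_derivative_continuous)
  have gint: "integrable lborel g"
    using integrable_continuous_compact_support[OF gcont K supp] .
  have "compact ((\<lambda>x. g' x v) ` K)"
    using K cont by (intro compact_continuous_image) (auto intro: continuous_on_subset)
  then obtain B0 where B0: "\<And>x. x \<in> K \<Longrightarrow> \<bar>g' x v\<bar> \<le> B0"
    using compact_imp_bounded[of "(\<lambda>x. g' x v) ` K"] by (auto simp: bounded_real)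
  (* B0 may be negative when K is empty. *)
  define B where "B = max B0 0"
  have B: "\<bar>g' x v\<bar> \<le> B" for x
    using B0[of x] zero[of x] by (cases "x \<in> K") (auto simp: B_def)
  have der_line: "((\<lambda>t. g (x + t *\<^sub>R v)) has_real_derivative g' (x + t *\<^sub>R v) v) (at t)" for x t
  proof -
    have "((\<lambda>t. g (x + t *\<^sub>R v)) has_derivative (\<lambda>h. g' (x + t *\<^sub>R v) (h *\<^sub>R v))) (at t)"
      by (rule has_derivative_compose[where g = g, OF _ der]) (auto intro!: derivative_eq_intros)
    moreover have "g' (x + t *\<^sub>R v) (h *\<^sub>R v) = h * g' (x + t *\<^sub>R v) v" for h
      using linear_cmul[OF has_derivative_linear[OF der]] by simp
    ultimately show ?thesis
      by (simp add: has_field_derivative_def mult.commute[of _ "g' (x + t *\<^sub>R v) v"])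
  qed
  have lip: "\<bar>g (x + t *\<^sub>R v) - g x\<bar> \<le> B * \<bar>t\<bar>" for x t
    using field_differentiable_bound[of UNIV "\<lambda>t. g (x + t *\<^sub>R v)" "\<lambda>t. g' (x + t *\<^sub>R v) v" B t 0]
      der_line[of x] B
    by (auto simp: has_field_derivative_at_within)
  obtain R where R: "\<And>x. x \<in> K \<Longrightarrow> norm x \<le> R"
    using compact_imp_bounded[OF K] by (auto simp: bounded_iff)
  (* The difference quotients for the steps t = 1 / (n + 1). *)
  define q where "q n x = (g (x + (1 / real (Suc n)) *\<^sub>R v) - g x) * real (Suc n)" for n x
  have qint: "integral\<^sup>L lborel (q n) = 0" for n
  proof -
    let ?t = "(1 / real (Suc n)) *\<^sub>R v"
    have shift: "distr lborel borel (\<lambda>x. ?t + x) = lborel"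
      by (rule lborel_distr_plus)
    have gm: "g \<in> borel_measurable borel"
      using gcont by (rule borel_measurable_continuous_onI)
    have 1: "integrable lborel (\<lambda>x. g (x + ?t))"
      using integrable_distr_eq[of "\<lambda>x. ?t + x" lborel borel g] gm gint
      unfolding shift by (simp add: add.commute)
    have 2: "(LINT x|lborel. g (x + ?t)) = integral\<^sup>L lborel g"
      using integral_distr[of "\<lambda>x. ?t + x" lborel borel g] gm
      unfolding shift by (simp add: add.commute)
    show ?thesis
      unfolding q_def using 1 2 gint by simp
  qed
  have bound: "\<bar>q n x\<bar> \<le> indicator (cball 0 (R + norm v)) x * B" for n x
  proof (cases "x \<in> cball 0 (R + norm v)")
    case True
    then show ?thesis
      using lip[of x "1 / real (Suc n)"] by (simp add: q_def abs_mult pos_le_divide_eq del: of_nat_Suc)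
  next
    case False
    then have big: "norm x > R + norm v"
      by simp
    have "norm ((1 / real (Suc n)) *\<^sub>R v) \<le> norm v"
      using mult_left_le_one_le[of "norm v" "1 / real (Suc n)"] by simp
    then have "norm (x + (1 / real (Suc n)) *\<^sub>R v) > R"
      using big norm_diff_ineq[of x "(1 / real (Suc n)) *\<^sub>R v"] by linarith
    moreover have "norm x > R"
      using big norm_ge_zero[of v] by linarith
    ultimately have "x + (1 / real (Suc n)) *\<^sub>R v \<notin> K" "x \<notin> K"
      using R by (meson not_le)+
    then show ?thesis
      using False by (simp add: q_def supp)
  qed
  have lim: "(\<lambda>n. q n x) \<longlonglongrightarrow> g' x v" for x
  proof -
    have "((\<lambda>t. (g (x + t *\<^sub>R v) - g x) / t) \<longlongrightarrow> g' x v) (at 0)"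
      using der_line[of x 0] by (simp add: DERIV_def)
    moreover have "filterlim (\<lambda>n. 1 / real (Suc n)) (at 0) sequentially"
      using LIMSEQ_Suc[OF lim_1_over_n] by (auto simp: filterlim_at)
    ultimately have "(\<lambda>n. (g (x + (1 / real (Suc n)) *\<^sub>R v) - g x) / (1 / real (Suc n))) \<longlonglongrightarrow> g' x v"
      by (rule filterlim_compose)
    then show ?thesis
      by (simp add: q_def)
  qed
  have "(\<lambda>n. integral\<^sup>L lborel (q n)) \<longlonglongrightarrow> (LINT x|lborel. g' x v)"
  proof (rule integral_dominated_convergence)
    show "(\<lambda>x. g' x v) \<in> borel_measurable lborel"
      using cont by (simp add: borel_measurable_continuous_onI)
    have "q n \<in> borel_measurable borel" for n
      unfolding q_def
      by (intro borel_measurable_continuous_onI continuous_intros continuous_on_compose2[OF gcont]) auto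
    then show "q n \<in> borel_measurable lborel" for n
      by simp
    have "integrable lborel (\<lambda>x. indicator (cball 0 (R + norm v)) x *\<^sub>R B)" 
      by (intro borel_integrable_compact) auto
    then show "integrable lborel (\<lambda>x::'a. indicator (cball 0 (R + norm v)) x * B)"
      by simp
  qed (use lim bound in auto)
  then show "(LINT x|lborel. g' x v) = 0"
    by (simp add: qint LIMSEQ_const_iff)
qed

lemma continuous_on_apply_vector_field:
  fixes f' :: "'a::topological_space \<Rightarrow> 'b::euclidean_space \<Rightarrow> 'c::real_normed_vector"
  assumes lin: "\<And>x. linear (f' x)" and cont: "\<And>v. continuous_on S (\<lambda>x. f' x v)"
    and X: "continuous_on S X"
  shows "continuous_on S (\<lambda>x. f' x (X x))"
proof -
  have "f' x (X x) = (\<Sum>b\<in>Basis. (X x \<bullet> b) *\<^sub>R f' x b)" for x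
  proof -
    interpret linear "f' x" by (rule lin)
    have "f' x (X x) = f' x (\<Sum>b\<in>Basis. (X x \<bullet> b) *\<^sub>R b)"
      by (simp only: euclidean_representation)
    then show ?thesis
      by (simp add: sum scale)
  qed
  then show ?thesis
    by (auto intro!: continuous_intros cont X)
qed

text \<open>If no component of the vector field \<open>X\<close> varies along its own coordinate, then
  \<open>X f\<close> is the sum of the \<open>\<partial>\<^sub>i (X\<^sub>i f)\<close>, each of which integrates to \<open>0\<close>.\<close>

lemma integral_vector_field_derivative_eq_zero:
  fixes f :: "real ^ 'n \<Rightarrow> real" and X :: "real ^ 'n \<Rightarrow> real ^ 'n"
  assumes der: "\<And>x. (f has_derivative f' x) (at x)"
    and cont: "\<And>v. continuous_on UNIV (\<lambda>x. f' x v)"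
    and K: "compact K" and supp: "\<And>x. x \<notin> K \<Longrightarrow> f x = 0"
    and X: "\<And>x. (X has_derivative X' x) (at x)"
    and X0: "\<And>x i. X' x (axis i 1) $ i = 0"
  shows "integrable lborel (\<lambda>x. f' x (X x))" and "(LINT x|lborel. f' x (X x)) = 0"
proof -
  have Xcont: "continuous_on UNIV X"
    by (meson X continuous_at_imp_continuous_on has_derivative_continuous)
  have expand: "f' x (X x) = (\<Sum>i\<in>UNIV. X x $ i * f' x (axis i 1))" for x
  proof -
    interpret linear "f' x" using der has_derivative_linear by blast
    have "f' x (X x) = f' x (\<Sum>i\<in>UNIV. X x $ i *\<^sub>R axis i 1)"
      using basis_expansion[of "X x"] by (simp add: scalar_mult_eq_scaleR)
    then show ?thesis
      by (simp add: sum scale)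
  qed
  have 1: "((\<lambda>x. X x $ i * f x) has_derivative (\<lambda>v. X x $ i * f' x v + X' x v $ i * f x)) (at x)" for i x
    using has_derivative_mult[OF bounded_linear.has_derivative[OF bounded_linear_vec_nth X] der]
    by simp
  have 2: "integrable lborel (\<lambda>x. X x $ i * f' x (axis i 1))"
          "(LINT x|lborel. X x $ i * f' x (axis i 1)) = 0" for i
    using integral_directional_derivative_eq_zero[OF 1[of i], where v = "axis i 1" and K = K] K supp X0
      continuous_on_mult[OF continuous_on_component[OF Xcont] cont]
    by simp_all
  show "integrable lborel (\<lambda>x. f' x (X x))" "(LINT x|lborel. f' x (X x)) = 0"
    unfolding expand using 2 by auto
qed

section \<open>The first stratum and its Jacobian generators\<close>

context stratified_group
begin

lemma mul_neutral [simp]: "mul 0 x = x" "mul x 0 = x"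
  by (simp_all add: left_neutral right_neutral)

lemma mul_ginv [simp]: "mul x (ginv x) = 0"
  by (rule right_inverse)

lemma has_derivative_mul:
  "((\<lambda>(x, y). mul x y) has_derivative frechet_derivative (\<lambda>(x, y). mul x y) (at z)) (at z)"
proof -
  have "Ck_on (Suc 0) (\<lambda>(x, y). mul x y) UNIV"
    using smooth_mul by (simp only: smooth_on_def)
  then have "\<forall>z. (\<lambda>(x, y). mul x y) differentiable (at z)"
    by (simp only: Ck_on.simps) simp
  then show ?thesis
    using frechet_derivative_works by blast
qed

text \<open>A component of the first stratum is homogeneous of degree one under the dilations of both
  arguments. Since \<open>s \<mapsto> \<delta>\<^sub>s x\<close> has at \<open>s = 0\<close> the derivative \<open>q x\<close>, the projection of \<open>x\<close> onto
  the first stratum, this component of \<open>x y\<close> equals its derivative at \<open>(0, 0)\<close>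
  applied to \<open>(q x, q y)\<close>. It is therefore additive in the pair \<open>(x, y)\<close>, and the cases \<open>y = 0\<close> and
  \<open>x = 0\<close> determine it.\<close>

lemma mul_first_stratum:
  assumes i: "\<sigma> i = 1"
  shows "mul x y $ i = x $ i + y $ i"
proof -
  define L where "L = frechet_derivative (\<lambda>(x, y). mul x y) (at 0)"
  define q :: "real ^ 'n \<Rightarrow> real ^ 'n" where "q z = (\<chi> j. (if \<sigma> j = 1 then z $ j else 0))" for z
  have L: "linear L"
    unfolding L_def using has_derivative_mul has_derivative_linear by blast
  have sig: "\<sigma> j \<ge> 1" for j
    using strata by (metis atLeastAtMost_iff rangeI)
  have pow: "((\<lambda>s. s ^ \<sigma> j * z $ j) has_derivative (\<lambda>h. (h *\<^sub>R q z) $ j)) (at 0)" for z j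
    using sig[of j]
    by (auto intro!: derivative_eq_intros simp: q_def fun_eq_iff power_0_left)
  have dil: "((\<lambda>s. dilation \<sigma> s z) has_derivative (\<lambda>h. h *\<^sub>R q z)) (at 0)" for z
    using pow
    by (subst has_derivative_componentwise_within)
      (auto simp: Basis_vec_def inner_axis dilation_def)
  have key: "mul a b $ i = L (q a, q b) $ i" for a b
  proof -
    have dil0: "dilation \<sigma> 0 z = 0" for z
      using sig by (simp add: dilation_def vec_eq_iff power_0_left) (metis not_one_le_zero One_nat_def)
    have "((\<lambda>s. (\<lambda>(x, y). mul x y) (dilation \<sigma> s a, dilation \<sigma> s b)) has_derivative
        (\<lambda>h. L (h *\<^sub>R q a, h *\<^sub>R q b))) (at 0)"
      by (rule has_derivative_compose[where g = "\<lambda>(x, y). mul x y"])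
        (use has_derivative_mul[of 0] in \<open>auto intro!: has_derivative_Pair dil simp: dil0 L_def zero_prod_def\<close>)
    then have "((\<lambda>s. mul (dilation \<sigma> s a) (dilation \<sigma> s b) $ i) has_derivative
        (\<lambda>h. L (h *\<^sub>R q a, h *\<^sub>R q b) $ i)) (at 0)"
      by (auto dest: bounded_linear.has_derivative[OF bounded_linear_vec_nth])
    moreover have "L (h *\<^sub>R q a, h *\<^sub>R q b) $ i = h * L (q a, q b) $ i" for h
      using linear_cmul[OF L, of h "(q a, q b)"] by simp
    ultimately have "((\<lambda>s. mul (dilation \<sigma> s a) (dilation \<sigma> s b) $ i) has_real_derivative
        L (q a, q b) $ i) (at 0)"
      by (simp add: has_field_derivative_def mult.commute[of _ "L (q a, q b) $ i"])
    then have "((\<lambda>s. mul (dilation \<sigma> s a) (dilation \<sigma> s b) $ i / s) \<longlongrightarrow> L (q a, q b) $ i) (at 0)"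
      by (simp add: DERIV_def dil0)
    then have "((\<lambda>s. mul (dilation \<sigma> s a) (dilation \<sigma> s b) $ i / s) \<longlongrightarrow> L (q a, q b) $ i) (at_right 0)"
      by (rule filterlim_mono) (auto simp: at_le)
    moreover have "eventually (\<lambda>s. mul (dilation \<sigma> s a) (dilation \<sigma> s b) $ i / s = mul a b $ i)
        (at_right (0::real))"
      using eventually_at_right_less[of "0::real"]
      by eventually_elim (simp only: dilation_mul[symmetric], simp add: dilation_def i)
    ultimately have "((\<lambda>s::real. mul a b $ i) \<longlongrightarrow> L (q a, q b) $ i) (at_right 0)"
      by (simp add: tendsto_cong)
    then show ?thesis
      by (simp add: tendsto_const_iff)
  qed
  have "q 0 = 0"
    by (simp add: q_def vec_eq_iff)
  then have "mul x y $ i = (L (q x, q 0) + L (q 0, q y)) $ i"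
    by (simp add: key linear_add[OF L, symmetric])
  also have "\<dots> = mul x 0 $ i + mul 0 y $ i"
    by (simp only: key vector_add_component)
  finally show ?thesis
    by simp
qed

lemma norm1_mul_ginv:
  "(norm1 \<sigma> (mul x (ginv x0)))\<^sup>2 = (\<Sum>i\<in>stratum \<sigma> 1. (x $ i - x0 $ i)\<^sup>2)"
proof -
  have "mul x (ginv x0) $ i = x $ i - x0 $ i" if "\<sigma> i = 1" for i
    using mul_first_stratum[OF that, of x "ginv x0"] mul_first_stratum[OF that, of x0 "ginv x0"]
    by simp
  then show ?thesis
    unfolding norm1_def L2_set_def by (simp add: sum_nonneg stratum_def)
qed

lemma has_derivative_left_translation:
  "(mul x has_derivative (\<lambda>v. frechet_derivative (\<lambda>(x, y). mul x y) (at (x, 0)) (0, v))) (at 0)"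
proof -
  have "((\<lambda>y. (\<lambda>(x, y). mul x y) (x, y)) has_derivative
      (\<lambda>v. frechet_derivative (\<lambda>(x, y). mul x y) (at (x, 0)) (0, v))) (at 0)"
    by (rule has_derivative_compose[where g = "\<lambda>(x, y). mul x y", OF _ has_derivative_mul])
      (auto intro!: derivative_eq_intros)
  then show ?thesis
    by simp
qed

lemma has_derivative_left_translation':
  "(mul x has_derivative frechet_derivative (mul x) (at 0)) (at 0)"
  using has_derivative_left_translation differentiableI frechet_derivative_works by blast

text \<open>The generator is a partial derivative of the smooth group law, restricted to points \<open>(x, 0)\<close>;
  this form makes its regularity in \<open>x\<close> visible.\<close>

lemma jacobian_generator_eq:
  "jacobian_generator mul k x = frechet_derivative (\<lambda>(x, y). mul x y) (at (x, 0)) (0, axis k 1)"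
  unfolding jacobian_generator_def
  by (simp add: frechet_derivative_at[OF has_derivative_left_translation, symmetric])

lemma jacobian_generator_C1:
  shows "(jacobian_generator mul k has_derivative
      frechet_derivative (jacobian_generator mul k) (at x)) (at x)"
    and "continuous_on UNIV (\<lambda>x. frechet_derivative (jacobian_generator mul k) (at x) v)"
proof -
  let ?F = "\<lambda>(x, y). mul x y"
  let ?G = "\<lambda>z. frechet_derivative ?F (at z) (0, axis k 1)"
  have C2: "Ck_on (Suc (Suc 0)) ?F UNIV"
    using smooth_mul by (simp only: smooth_on_def)
  then have "\<forall>z. ?G differentiable (at z)"
    by (simp only: Ck_on.simps) simp
  then have dG: "(?G has_derivative frechet_derivative ?G (at z)) (at z)" for z
    using frechet_derivative_works by blast
  have cG: "continuous_on UNIV (\<lambda>z. frechet_derivative ?G (at z) w)" for w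
    using C2 by (simp only: Ck_on.simps)
  have d: "(jacobian_generator mul k has_derivative (\<lambda>v. frechet_derivative ?G (at (x, 0)) (v, 0))) (at x)" for x
    unfolding jacobian_generator_eq[abs_def]
    by (rule has_derivative_compose[where g = ?G, OF _ dG]) (auto intro!: derivative_eq_intros)
  have fd: "frechet_derivative (jacobian_generator mul k) (at x) = (\<lambda>v. frechet_derivative ?G (at (x, 0)) (v, 0))" for x
    using frechet_derivative_at[OF d] by simp
  show "(jacobian_generator mul k has_derivative
      frechet_derivative (jacobian_generator mul k) (at x)) (at x)"
    unfolding fd by (rule d)
  show "continuous_on UNIV (\<lambda>x. frechet_derivative (jacobian_generator mul k) (at x) v)"
    unfolding fd by (rule continuous_on_compose2[OF cG]) (auto intro!: continuous_intros)
qed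

lemma linear_dilation: "linear (dilation \<sigma> s)"
  by (auto intro!: linearI simp: dilation_def vec_eq_iff algebra_simps)

lemma dilation_axis: "dilation \<sigma> s (axis j 1) = s ^ \<sigma> j *\<^sub>R axis j 1"
  by (auto simp: dilation_def vec_eq_iff axis_def)

text \<open>The generators of the first stratum are homogeneous of degree one as vector fields: differentiate
  \<open>\<delta>\<^sub>s (x y) = \<delta>\<^sub>s x \<delta>\<^sub>s y\<close> in \<open>y\<close> at \<open>0\<close> in the direction of the \<open>k\<close>-th axis, which \<open>\<delta>\<^sub>s\<close> scales
  by \<open>s\<close>.\<close>

lemma jacobian_generator_dilation:
  assumes k: "\<sigma> k = 1" and s: "s > 0"
  shows "s *\<^sub>R jacobian_generator mul k (dilation \<sigma> s x) = dilation \<sigma> s (jacobian_generator mul k x)"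
proof -
  have bl: "bounded_linear (dilation \<sigma> s)"
    using linear_dilation linear_conv_bounded_linear by blast
  have dil0: "dilation \<sigma> s 0 = 0"
    by (simp add: dilation_def vec_eq_iff)
  have "((\<lambda>y. mul (dilation \<sigma> s x) (dilation \<sigma> s y)) has_derivative
      (\<lambda>v. frechet_derivative (mul (dilation \<sigma> s x)) (at 0) (dilation \<sigma> s v))) (at 0)"
    by (rule has_derivative_compose[OF bounded_linear_imp_has_derivative[OF bl]])
      (simp add: dil0 has_derivative_left_translation')
  moreover have "((\<lambda>y. dilation \<sigma> s (mul x y)) has_derivative
      (\<lambda>v. dilation \<sigma> s (frechet_derivative (mul x) (at 0) v))) (at 0)"
    by (rule bounded_linear.has_derivative[OF bl has_derivative_left_translation'])
  ultimately have "(\<lambda>v. frechet_derivative (mul (dilation \<sigma> s x)) (at 0) (dilation \<sigma> s v))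
      = (\<lambda>v. dilation \<sigma> s (frechet_derivative (mul x) (at 0) v))"
    unfolding dilation_mul[OF s] by (rule has_derivative_unique)
  from fun_cong[OF this, of "axis k 1"] show ?thesis
    unfolding jacobian_generator_def
    by (simp add: dilation_axis k linear_cmul[OF has_derivative_linear[OF has_derivative_left_translation']])
qed

lemma tendsto_dilation_0: "((\<lambda>s. dilation \<sigma> s x) \<longlongrightarrow> 0) (at_right 0)"
proof (rule vec_tendstoI)
  fix i
  have "\<sigma> i \<noteq> 0"
    using strata by (metis atLeastAtMost_iff not_one_le_zero rangeI)
  then have "((\<lambda>s::real. s ^ \<sigma> i * x $ i) \<longlongrightarrow> 0 ^ \<sigma> i * x $ i) (at_right 0)"
    by (intro tendsto_intros)
  then show "((\<lambda>s. dilation \<sigma> s x $ i) \<longlongrightarrow> 0 $ i) (at_right 0)"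
    using \<open>\<sigma> i \<noteq> 0\<close> by (simp add: dilation_def power_0_left)
qed

lemma jacobian_generator_first_stratum:
  assumes k: "\<sigma> k = 1" and i: "\<sigma> i = 1"
  shows "jacobian_generator mul k x $ i = (if i = k then 1 else 0)"
proof -
  have "((\<lambda>y. mul x y $ i) has_derivative (\<lambda>v. frechet_derivative (mul x) (at 0) v $ i)) (at 0)"
    by (rule bounded_linear.has_derivative[OF bounded_linear_vec_nth has_derivative_left_translation'])
  moreover have "((\<lambda>y. mul x y $ i) has_derivative (\<lambda>v. v $ i)) (at 0)"
    unfolding mul_first_stratum[OF i]
    by (auto intro!: derivative_eq_intros bounded_linear.has_derivative[OF bounded_linear_vec_nth])
  ultimately have "(\<lambda>v. frechet_derivative (mul x) (at 0) v $ i) = (\<lambda>v. v $ i)"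
    using has_derivative_unique by blast
  from fun_cong[OF this, of "axis k 1"] show ?thesis
    unfolding jacobian_generator_def by (auto simp: axis_def)
qed

text \<open>The \<open>i\<close>-th component of the generator is homogeneous of degree \<open>\<sigma> i - 1\<close>, and \<open>\<partial>\<^sub>i\<close> lowers the
  degree by \<open>\<sigma> i\<close>. This leaves degree \<open>-1\<close>, which forces a function continuous at \<open>0\<close> to
  vanish. In particular the generator is divergence-free.\<close>

lemma jacobian_generator_own_partial_eq_zero:
  assumes k: "\<sigma> k = 1"
  shows "frechet_derivative (jacobian_generator mul k) (at x) (axis i 1) $ i = 0"
proof -
  let ?X = "jacobian_generator mul k"
  let ?D = "\<lambda>x. frechet_derivative (jacobian_generator mul k) (at x)"
  have hom: "s * ?D (dilation \<sigma> s x) (axis i 1) $ i = ?D x (axis i 1) $ i" if s: "s > 0" for s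
  proof -
    have bl: "bounded_linear (dilation \<sigma> s)"
      using linear_dilation linear_conv_bounded_linear by blast
    have "((\<lambda>x. s *\<^sub>R ?X (dilation \<sigma> s x)) has_derivative
        (\<lambda>v. s *\<^sub>R ?D (dilation \<sigma> s x) (dilation \<sigma> s v))) (at x)"
      by (intro has_derivative_scaleR_right
          has_derivative_compose[OF bounded_linear_imp_has_derivative[OF bl]] jacobian_generator_C1)
    moreover have "((\<lambda>x. dilation \<sigma> s (?X x)) has_derivative (\<lambda>v. dilation \<sigma> s (?D x v))) (at x)"
      by (rule bounded_linear.has_derivative[OF bl jacobian_generator_C1(1)])
    ultimately have "(\<lambda>v. s *\<^sub>R ?D (dilation \<sigma> s x) (dilation \<sigma> s v)) = (\<lambda>v. dilation \<sigma> s (?D x v))"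
      unfolding jacobian_generator_dilation[OF k s] by (rule has_derivative_unique)
    from fun_cong[OF this, of "axis i 1"]
    have "s *\<^sub>R s ^ \<sigma> i *\<^sub>R ?D (dilation \<sigma> s x) (axis i 1) = dilation \<sigma> s (?D x (axis i 1))"
      by (simp only: dilation_axis linear_cmul[OF has_derivative_linear[OF jacobian_generator_C1(1)]])
    from arg_cong[OF this, of "\<lambda>z. z $ i"] s show ?thesis
      by (simp add: dilation_def)
  qed
  have "((\<lambda>s. ?D (dilation \<sigma> s x) (axis i 1)) \<longlongrightarrow> ?D 0 (axis i 1)) (at_right 0)"
    by (rule continuous_on_tendsto_compose[OF jacobian_generator_C1(2) tendsto_dilation_0]) auto
  then have "((\<lambda>s. s * ?D (dilation \<sigma> s x) (axis i 1) $ i) \<longlongrightarrow> 0 * ?D 0 (axis i 1) $ i) (at_right 0)"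
    by (intro tendsto_intros)
  moreover have "eventually (\<lambda>s. s * ?D (dilation \<sigma> s x) (axis i 1) $ i = ?D x (axis i 1) $ i) (at_right (0::real))"
    using eventually_at_right_less[of "0::real"] by eventually_elim (rule hom)
  ultimately have "((\<lambda>s::real. ?D x (axis i 1) $ i) \<longlongrightarrow> 0) (at_right 0)"
    by (simp add: tendsto_cong)
  then show ?thesis
    by (simp add: tendsto_const_iff)
qed

end

section \<open>A weighted inequality by completing squares\<close>

text \<open>Expanding \<open>0 \<le> w \<Sum>\<^sub>k |X\<^sub>k u + c\<^sub>k u|\<^sup>2\<close> produces the cross term \<open>w c\<^sub>k X\<^sub>k |u|\<^sup>2\<close>, which
  integration by parts turns into \<open>- X\<^sub>k (w c\<^sub>k) |u|\<^sup>2\<close>.\<close>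

lemma weighted_inequality_completing_squares:
  fixes u :: "real ^ 'n \<Rightarrow> 'b::real_inner" and X :: "'k \<Rightarrow> real ^ 'n \<Rightarrow> real ^ 'n"
    and w :: "real ^ 'n \<Rightarrow> real" and c :: "'k \<Rightarrow> real ^ 'n \<Rightarrow> real"
  assumes u: "\<And>x. (u has_derivative u' x) (at x)"
    and u'_cont: "\<And>v. continuous_on UNIV (\<lambda>x. u' x v)"
    and K: "compact K" and supp: "\<And>x. x \<notin> K \<Longrightarrow> u x = 0"
    and X: "\<And>k x. k \<in> S \<Longrightarrow> (X k has_derivative X' k x) (at x)"
    and X0: "\<And>k x i. k \<in> S \<Longrightarrow> X' k x (axis i 1) $ i = 0"
    and w: "continuous_on UNIV w" "\<And>x. w x \<ge> 0"
    and c: "\<And>k. k \<in> S \<Longrightarrow> continuous_on UNIV (c k)"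
    and p: "\<And>k x. k \<in> S \<Longrightarrow> ((\<lambda>x. w x * c k x) has_derivative p' k x) (at x)"
    and p'_cont: "\<And>k v. k \<in> S \<Longrightarrow> continuous_on UNIV (\<lambda>x. p' k x v)"
  shows "integrable lborel (\<lambda>x. ((\<Sum>k\<in>S. p' k x (X k x)) - w x * (\<Sum>k\<in>S. (c k x)\<^sup>2)) * (norm (u x))\<^sup>2)"
      (is "integrable lborel ?L")
    and "(LINT x|lborel. ((\<Sum>k\<in>S. p' k x (X k x)) - w x * (\<Sum>k\<in>S. (c k x)\<^sup>2)) * (norm (u x))\<^sup>2)
      \<le> (LINT x|lborel. w x * (\<Sum>k\<in>S. (norm (u' x (X k x)))\<^sup>2))"
proof -
  define f' where "f' k x v = w x * c k x * (2 * (u x \<bullet> u' x v)) + p' k x v * (norm (u x))\<^sup>2" for k x v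
  have u_cont: "continuous_on UNIV u"
    by (meson u continuous_at_imp_continuous_on has_derivative_continuous)
  have zero: "u' x v = 0" if "x \<notin> K" for x v
    using has_derivative_eq_zero_outside_support[OF u compact_imp_closed[OF K] supp that] by metis
  have f: "((\<lambda>x. (w x * c k x) * (norm (u x))\<^sup>2) has_derivative f' k x) (at x)" if "k \<in> S" for k x
  proof -
    have "((\<lambda>x. (norm (u x))\<^sup>2) has_derivative (\<lambda>v. 2 * (u x \<bullet> u' x v))) (at x)"
      unfolding power2_norm_eq_inner
      using has_derivative_inner[OF u u] by (simp add: inner_commute)
    from has_derivative_mult[OF p[OF that] this] show ?thesis
      unfolding f'_def .
  qed
  have f'_cont: "continuous_on UNIV (\<lambda>x. f' k x v)" if "k \<in> S" for k v
    unfolding f'_def by (intro continuous_intros w c p'_cont u_cont u'_cont that)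
  have ibp: "integrable lborel (\<lambda>x. f' k x (X k x))" "(LINT x|lborel. f' k x (X k x)) = 0"
    if "k \<in> S" for k
    using integral_vector_field_derivative_eq_zero[OF f[OF that] f'_cont[OF that] K _ X[OF that] X0[OF that]]
      supp by auto
  have Du_cont: "continuous_on UNIV (\<lambda>x. u' x (X k x))" if "k \<in> S" for k
    by (rule continuous_on_apply_vector_field[OF has_derivative_linear[OF u] u'_cont])
      (meson X[OF that] continuous_at_imp_continuous_on has_derivative_continuous)
  let ?Q = "\<lambda>x. w x * (\<Sum>k\<in>S. (norm (u' x (X k x) + c k x *\<^sub>R u x))\<^sup>2)"
  let ?R = "\<lambda>x. w x * (\<Sum>k\<in>S. (norm (u' x (X k x)))\<^sup>2)"
  have Q: "integrable lborel ?Q"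
    by (rule integrable_continuous_compact_support[OF _ K])
      (auto intro!: continuous_intros w c u_cont Du_cont simp: zero supp)
  have R: "integrable lborel ?R"
    by (rule integrable_continuous_compact_support[OF _ K])
      (auto intro!: continuous_intros w Du_cont simp: zero)
  have square: "(norm (u' x (X k x) + c k x *\<^sub>R u x))\<^sup>2 =
      (norm (u' x (X k x)))\<^sup>2 + c k x * (2 * (u x \<bullet> u' x (X k x))) + (c k x)\<^sup>2 * (norm (u x))\<^sup>2" for k x
    unfolding power2_norm_eq_inner by (simp add: inner_simps inner_commute power2_eq_square)
  have eq: "?L x = ?R x - ?Q x + (\<Sum>k\<in>S. f' k x (X k x))" for x
    unfolding square f'_def
    by (simp add: sum.distrib sum_distrib_left sum_distrib_right algebra_simps)
  show "integrable lborel ?L"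
    unfolding eq using Q R ibp by auto
  have "integral\<^sup>L lborel ?L = integral\<^sup>L lborel ?R - integral\<^sup>L lborel ?Q"
    unfolding eq using Q R ibp by simp
  also have "\<dots> \<le> integral\<^sup>L lborel ?R"
    by (simp add: integral_nonneg_AE w sum_nonneg)
  finally show "integral\<^sup>L lborel ?L \<le> integral\<^sup>L lborel ?R" .
qed

section \<open>The Hardy inequality with Gaussian weight\<close>

text \<open>The square is completed with \<open>c = m x' / (|x'|\<^sup>2 + \<epsilon>) - (x' - a') / (4 \<lambda>)\<close>. In the resulting
  potential the products of the two summands of \<open>c\<close> cancel, and the Hardy part equals
  \<open>m\<^sup>2 / (|x'|\<^sup>2 + \<epsilon>) + (m\<^sup>2 + 2 m) \<epsilon> / (|x'|\<^sup>2 + \<epsilon>)\<^sup>2\<close>, whose second term is nonnegative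
  because \<open>m = (N - 2) / 2 \<ge> 0\<close>.\<close>

lemma (in stratified_group) gaussian_hardy_regularised:
  fixes u :: "real ^ 'n \<Rightarrow> 'b::real_inner" and a :: "real ^ 'n" and lam :: real
  defines "S \<equiv> stratum \<sigma> 1"
  defines "w \<equiv> \<lambda>x. exp (- (\<Sum>i\<in>S. (x $ i - a $ i)\<^sup>2) / (4 * lam))"
  assumes u: "\<And>x. (u has_derivative u' x) (at x)"
    and u'_cont: "\<And>v. continuous_on UNIV (\<lambda>x. u' x v)"
    and K: "compact K" and supp: "\<And>x. x \<notin> K \<Longrightarrow> u x = 0"
    and N: "card S \<ge> 2" and lam: "lam > 0" and eps: "\<epsilon> > 0"
  shows "(LINT x|lborel. w x * ((real (card S) - 2)\<^sup>2 / (4 * ((\<Sum>i\<in>S. (x $ i)\<^sup>2) + \<epsilon>)) - real (card S) / (4 * lam)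
            + (\<Sum>i\<in>S. (x $ i - a $ i)\<^sup>2) / (16 * lam\<^sup>2)) * (norm (u x))\<^sup>2)
      \<le> (LINT x|lborel. w x * (\<Sum>k\<in>S. (norm (u' x (jacobian_generator mul k x)))\<^sup>2))"
proof -
  let ?X = "jacobian_generator mul"
  define m where "m = (real (card S) - 2) / 2"
  define s where "s x = (\<Sum>i\<in>S. (x $ i)\<^sup>2)" for x :: "real ^ 'n"
  define t where "t x = (\<Sum>i\<in>S. (x $ i - a $ i)\<^sup>2)" for x :: "real ^ 'n"
  define c where "c k x = m * x $ k / (s x + \<epsilon>) - (x $ k - a $ k) / (4 * lam)" for k and x :: "real ^ 'n"
  define p' where "p' k x v = w x * (- (\<Sum>i\<in>S. 2 * (x $ i - a $ i) * v $ i) / (4 * lam) * c k x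
      + m * v $ k / (s x + \<epsilon>) - m * x $ k * (\<Sum>i\<in>S. 2 * x $ i * v $ i) / (s x + \<epsilon>)\<^sup>2
      - v $ k / (4 * lam))" for k x v
  have S: "k \<in> S \<longleftrightarrow> \<sigma> k = 1" for k
    by (simp add: S_def stratum_def)
  have m: "m \<ge> 0" and cardS: "real (card S) = 2 * m + 2"
    using N by (simp_all add: m_def field_simps)
  have s_eps: "s x + \<epsilon> > 0" for x
    using eps by (simp_all add: s_def sum_nonneg add_nonneg_pos)
  have w_eq: "w x = exp (- t x / (4 * lam))" for x
    by (simp add: w_def t_def)
  have [continuous_intros]: "continuous_on UNIV s" "continuous_on UNIV t"
    unfolding s_def t_def by (intro continuous_intros)+
  have w_cont [continuous_intros]: "continuous_on UNIV w"
    unfolding w_eq using lam by (auto intro!: continuous_intros)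
  have c_cont [continuous_intros]: "continuous_on UNIV (c k)" for k
    unfolding c_def using s_eps lam by (intro continuous_intros) (auto simp: less_imp_neq[symmetric])
  have nth: "((\<lambda>x. x $ k) has_derivative (\<lambda>v. v $ k)) (at x)" for k and x :: "real ^ 'n"
    by (rule bounded_linear_imp_has_derivative[OF bounded_linear_vec_nth])
  have ds: "(s has_derivative (\<lambda>v. \<Sum>i\<in>S. 2 * x $ i * v $ i)) (at x)" for x
    unfolding s_def by (auto intro!: derivative_eq_intros nth simp: algebra_simps)
  have dt: "(t has_derivative (\<lambda>v. \<Sum>i\<in>S. 2 * (x $ i - a $ i) * v $ i)) (at x)" for x
    unfolding t_def by (auto intro!: derivative_eq_intros nth simp: algebra_simps)
  have p: "((\<lambda>x. w x * c k x) has_derivative p' k x) (at x)" for k x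
  proof -
    have dw: "(w has_derivative (\<lambda>v. w x * (- (\<Sum>i\<in>S. 2 * (x $ i - a $ i) * v $ i) / (4 * lam)))) (at x)"
      unfolding w_eq[abs_def] using lam by (auto intro!: derivative_eq_intros dt)
    have dc: "(c k has_derivative (\<lambda>v. m * v $ k / (s x + \<epsilon>)
        - m * x $ k * (\<Sum>i\<in>S. 2 * x $ i * v $ i) / (s x + \<epsilon>)\<^sup>2 - v $ k / (4 * lam))) (at x)"
      unfolding c_def[abs_def]
    proof (rule has_derivative_diff)
      have "((\<lambda>x. m * x $ k / (s x + \<epsilon>)) has_derivative (\<lambda>v. (m * v $ k * (s x + \<epsilon>)
          - m * x $ k * (\<Sum>i\<in>S. 2 * x $ i * v $ i)) / ((s x + \<epsilon>) * (s x + \<epsilon>)))) (at x)"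
        using s_eps[of x]
        by (intro has_derivative_divide') (auto intro!: derivative_eq_intros ds nth)
      also have "(\<lambda>v. (m * v $ k * (s x + \<epsilon>) - m * x $ k * (\<Sum>i\<in>S. 2 * x $ i * v $ i))
            / ((s x + \<epsilon>) * (s x + \<epsilon>)))
          = (\<lambda>v. m * v $ k / (s x + \<epsilon>) - m * x $ k * (\<Sum>i\<in>S. 2 * x $ i * v $ i) / (s x + \<epsilon>)\<^sup>2)"
        using s_eps[of x] by (simp add: diff_divide_distrib power2_eq_square)
      finally show "((\<lambda>x. m * x $ k / (s x + \<epsilon>)) has_derivative (\<lambda>v. m * v $ k / (s x + \<epsilon>)
          - m * x $ k * (\<Sum>i\<in>S. 2 * x $ i * v $ i) / (s x + \<epsilon>)\<^sup>2)) (at x)" .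
      show "((\<lambda>x. (x $ k - a $ k) / (4 * lam)) has_derivative (\<lambda>v. v $ k / (4 * lam))) (at x)"
        using lam by (auto intro!: derivative_eq_intros nth)
    qed
    show ?thesis
      by (rule has_derivative_eq_rhs[OF has_derivative_mult[OF dw dc]])
        (simp add: p'_def fun_eq_iff algebra_simps)
  qed
  have p'_cont: "continuous_on UNIV (\<lambda>x. p' k x v)" for k v
    unfolding p'_def using s_eps lam by (intro continuous_intros) (auto simp: less_imp_neq[symmetric])
  have p'_X: "p' k x (?X k x) = w x * (- 2 * (x $ k - a $ k) / (4 * lam) * c k x
      + m / (s x + \<epsilon>) - 2 * m * (x $ k)\<^sup>2 / (s x + \<epsilon>)\<^sup>2 - 1 / (4 * lam))" if "k \<in> S" for k x
  proof -
    have "(\<Sum>i\<in>S. f i * ?X k x $ i) = (\<Sum>i\<in>S. if i = k then f i else 0)" for f :: "'n \<Rightarrow> real"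
      using that by (intro sum.cong) (auto simp: jacobian_generator_first_stratum S)
    then have "(\<Sum>i\<in>S. f i * ?X k x $ i) = f k" for f :: "'n \<Rightarrow> real"
      using that by simp
    moreover have "?X k x $ k = 1"
      using that by (simp add: jacobian_generator_first_stratum S)
    ultimately show ?thesis
      by (simp only: p'_def power2_eq_square) (simp add: mult.assoc)
  qed
  let ?L = "\<lambda>x. ((\<Sum>k\<in>S. p' k x (?X k x)) - w x * (\<Sum>k\<in>S. (c k x)\<^sup>2)) * (norm (u x))\<^sup>2"
  let ?A = "\<lambda>x. w x * (m\<^sup>2 / (s x + \<epsilon>) - real (card S) / (4 * lam) + t x / (16 * lam\<^sup>2)) * (norm (u x))\<^sup>2"
  have L: "integrable lborel ?L"
    "integral\<^sup>L lborel ?L \<le> (LINT x|lborel. w x * (\<Sum>k\<in>S. (norm (u' x (?X k x)))\<^sup>2))"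
    by (rule weighted_inequality_completing_squares[OF u u'_cont K supp
          jacobian_generator_C1(1) jacobian_generator_own_partial_eq_zero w_cont _ c_cont p p'_cont];
        simp add: S w_def)+
  have pointwise: "?A x \<le> ?L x" for x
  proof -
    have summand: "p' k x (?X k x) - w x * (c k x)\<^sup>2 =
        w x * ((x $ k - a $ k)\<^sup>2 / (16 * lam\<^sup>2) - 1 / (4 * lam) + m / (s x + \<epsilon>)
          - (m\<^sup>2 + 2 * m) / (s x + \<epsilon>)\<^sup>2 * (x $ k)\<^sup>2)" if "k \<in> S" for k
      unfolding p'_X[OF that] c_def using lam s_eps[of x]
      by (simp add: power2_eq_square divide_simps) (simp add: algebra_simps)
    have "(\<Sum>k\<in>S. p' k x (?X k x)) - w x * (\<Sum>k\<in>S. (c k x)\<^sup>2)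
        = (\<Sum>k\<in>S. p' k x (?X k x) - w x * (c k x)\<^sup>2)"
      by (simp add: sum_subtractf sum_distrib_left)
    also have "\<dots> = w x * (\<Sum>k\<in>S. (x $ k - a $ k)\<^sup>2 / (16 * lam\<^sup>2) - 1 / (4 * lam) + m / (s x + \<epsilon>)
          - (m\<^sup>2 + 2 * m) / (s x + \<epsilon>)\<^sup>2 * (x $ k)\<^sup>2)"
      by (simp only: summand sum_distrib_left cong: sum.cong)
    also have "\<dots> = w x * (t x / (16 * lam\<^sup>2) - real (card S) / (4 * lam) + real (card S) * m / (s x + \<epsilon>)
          - (m\<^sup>2 + 2 * m) / (s x + \<epsilon>)\<^sup>2 * s x)"
      by (simp only: sum.distrib sum_subtractf sum_distrib_left[symmetric] sum_divide_distrib[symmetric]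
          t_def[symmetric] s_def[symmetric]) simp
    finally have Leq: "?L x = w x * (t x / (16 * lam\<^sup>2) - real (card S) / (4 * lam) + real (card S) * m / (s x + \<epsilon>)
          - (m\<^sup>2 + 2 * m) / (s x + \<epsilon>)\<^sup>2 * s x) * (norm (u x))\<^sup>2" by simp
    have "real (card S) * m / (s x + \<epsilon>) - (m\<^sup>2 + 2 * m) / (s x + \<epsilon>)\<^sup>2 * s x - m\<^sup>2 / (s x + \<epsilon>)
        = (m\<^sup>2 + 2 * m) * \<epsilon> / (s x + \<epsilon>)\<^sup>2"
      using s_eps[of x] unfolding cardS
      by (simp add: power2_eq_square divide_simps) (simp add: algebra_simps)
    moreover have "\<dots> \<ge> 0"
      using m eps by simp
    ultimately show ?thesis
      unfolding Leq by (intro mult_right_mono mult_left_mono) (auto simp: w_def)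
  qed
  have A: "integrable lborel ?A"
    using s_eps lam
    by (intro integrable_continuous_compact_support[OF _ K] continuous_intros)
      (auto simp: supp less_imp_neq[symmetric] intro!: continuous_at_imp_continuous_on has_derivative_continuous[OF u])
  have "integral\<^sup>L lborel ?A \<le> integral\<^sup>L lborel ?L"
    by (rule integral_mono[OF A L(1) pointwise])
  also note L(2)
  also have "?A = (\<lambda>x. w x * ((real (card S) - 2)\<^sup>2 / (4 * ((\<Sum>i\<in>S. (x $ i)\<^sup>2) + \<epsilon>)) - real (card S) / (4 * lam)
            + (\<Sum>i\<in>S. (x $ i - a $ i)\<^sup>2) / (16 * lam\<^sup>2)) * (norm (u x))\<^sup>2)"
    by (simp add: m_def s_def t_def power_divide)
  finally show ?thesis .
qed

lemma AE_first_stratum_nonzero: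
  fixes S :: "'n::finite set"
  assumes "S \<noteq> {}"
  shows "AE x in lborel. (\<Sum>i\<in>S. ((x :: real ^ 'n) $ i)\<^sup>2) \<noteq> 0"
proof -
  obtain i where i: "i \<in> S"
    using assms by blast
  have "{x :: real ^ 'n. x $ i = 0} = {x. axis i 1 \<bullet> x = 0}"
    by (simp add: inner_axis inner_commute)
  then have "negligible {x :: real ^ 'n. x $ i = 0}" "closed {x :: real ^ 'n. x $ i = 0}"
    using negligible_hyperplane[of "axis i 1 :: real ^ 'n" 0] closed_hyperplane[of "axis i 1 :: real ^ 'n" 0]
    by (simp_all add: axis_eq_0_iff)
  then have "{x :: real ^ 'n. x $ i = 0} \<in> null_sets lborel"
    by (simp add: negligible_iff_null_sets null_sets_completion_iff borel_closed)
  then show ?thesis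
  proof (rule AE_I')
    show "{x \<in> space lborel. \<not> (\<Sum>i\<in>S. (x $ i)\<^sup>2) \<noteq> 0} \<subseteq> {x :: real ^ 'n. x $ i = 0}"
      using i by (auto simp: sum_nonneg_eq_0_iff)
  qed
qed

text \<open>As \<open>\<epsilon>\<close> decreases to \<open>0\<close>, the Hardy terms \<open>A \<epsilon>\<close> increase and their integrals stay bounded by the
  right-hand side minus the remaining part \<open>B\<close>. Monotone convergence gives both the
  integrability of the singular term and the inequality.\<close>

lemma (in stratified_group) gaussian_hardy:
  fixes u :: "real ^ 'n \<Rightarrow> 'b::real_inner" and a :: "real ^ 'n" and lam :: real
  defines "S \<equiv> stratum \<sigma> 1"
  defines "w \<equiv> \<lambda>x. exp (- (\<Sum>i\<in>S. (x $ i - a $ i)\<^sup>2) / (4 * lam))"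
  assumes u: "\<And>x. (u has_derivative u' x) (at x)"
    and u'_cont: "\<And>v. continuous_on UNIV (\<lambda>x. u' x v)"
    and K: "compact K" and supp: "\<And>x. x \<notin> K \<Longrightarrow> u x = 0"
    and N: "card S \<ge> 2" and lam: "lam > 0"
  shows "(LINT x|lborel. w x * ((real (card S) - 2)\<^sup>2 / (4 * (\<Sum>i\<in>S. (x $ i)\<^sup>2)) - real (card S) / (4 * lam)
            + (\<Sum>i\<in>S. (x $ i - a $ i)\<^sup>2) / (16 * lam\<^sup>2)) * (norm (u x))\<^sup>2)
      \<le> (LINT x|lborel. w x * (\<Sum>k\<in>S. (norm (u' x (jacobian_generator mul k x)))\<^sup>2))"
    (is "?lhs \<le> ?rhs")
proof -
  define s where "s x = (\<Sum>i\<in>S. (x $ i)\<^sup>2)" for x :: "real ^ 'n"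
  define C where "C = (real (card S) - 2)\<^sup>2 / 4"
  define A where "A \<epsilon> x = w x * (C / (s x + \<epsilon>)) * (norm (u x))\<^sup>2" for \<epsilon> x
  define B where "B x = w x * ((\<Sum>i\<in>S. (x $ i - a $ i)\<^sup>2) / (16 * lam\<^sup>2) - real (card S) / (4 * lam)) * (norm (u x))\<^sup>2" for x
  define e where "e n = 1 / real (Suc n)" for n
  have u_cont: "continuous_on UNIV u"
    by (meson u continuous_at_imp_continuous_on has_derivative_continuous)
  have w_cont: "continuous_on UNIV w" and s_cont: "continuous_on UNIV s"
    unfolding w_def s_def using lam by (auto intro!: continuous_intros)
  have e: "e n > 0" for n
    by (simp add: e_def)
  have e_mono: "e n \<le> e m" if "m \<le> n" for m n
    using that by (simp add: e_def frac_le)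
  have s: "s x \<ge> 0" for x
    by (simp add: s_def sum_nonneg)
  have pos: "s x + e n > 0" for x n
    using s[of x] e[of n] by simp
  have A_int: "integrable lborel (A (e n))" for n
    unfolding A_def using pos
    by (intro integrable_continuous_compact_support[OF _ K] continuous_intros u_cont w_cont s_cont)
      (auto simp: supp less_imp_neq[symmetric])
  have B_int: "integrable lborel B"
    unfolding B_def using lam
    by (intro integrable_continuous_compact_support[OF _ K] continuous_intros u_cont w_cont)
      (auto simp: supp)
  have A_mono: "A (e m) x \<le> A (e n) x" if "m \<le> n" for m n x
    unfolding A_def using pos e_mono[OF that]
    by (intro mult_right_mono mult_left_mono divide_left_mono) (auto simp: w_def C_def)
  have A_bound: "integral\<^sup>L lborel (A (e n)) \<le> ?rhs - integral\<^sup>L lborel B" for n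
  proof -
    have "integral\<^sup>L lborel (A (e n)) + integral\<^sup>L lborel B = (LINT x|lborel. A (e n) x + B x)"
      using A_int B_int by simp
    also have "\<dots> \<le> ?rhs"
      using gaussian_hardy_regularised[OF u u'_cont K supp N[unfolded S_def] lam e, where a = a, of n]
      by (simp add: A_def B_def C_def s_def w_def S_def algebra_simps)
    finally show ?thesis by simp
  qed
  have "incseq (\<lambda>n. integral\<^sup>L lborel (A (e n)))"
    by (intro incseq_SucI integral_mono A_int A_mono) simp
  then obtain l where l: "(\<lambda>n. integral\<^sup>L lborel (A (e n))) \<longlonglongrightarrow> l"
    using incseq_convergent[of "\<lambda>n. integral\<^sup>L lborel (A (e n))" "?rhs - integral\<^sup>L lborel B"] A_bound
    by blast
  have e_lim: "e \<longlonglongrightarrow> 0"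
    unfolding e_def using LIMSEQ_Suc[OF lim_1_over_n] by simp
  have A_lim: "AE x in lborel. (\<lambda>n. A (e n) x) \<longlonglongrightarrow> A 0 x"
  proof -
    have "S \<noteq> {}"
      using N by auto
    then have "AE x in lborel. s x \<noteq> 0"
      unfolding s_def by (rule AE_first_stratum_nonzero)
    then show ?thesis
      by eventually_elim (auto simp: A_def intro!: tendsto_eq_intros e_lim)
  qed
  have "A 0 \<in> borel_measurable borel"
    unfolding A_def[abs_def]
    by (intro borel_measurable_times borel_measurable_divide borel_measurable_add borel_measurable_const
        borel_measurable_power borel_measurable_continuous_onI continuous_on_norm u_cont w_cont s_cont)
  then have A0_meas: "A 0 \<in> borel_measurable lborel"
    by simp
  have A_nonneg: "A (e n) x \<ge> 0" for n x
    using pos[of x n] by (simp add: A_def w_def C_def)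
  have A0: "integrable lborel (A 0)" "integral\<^sup>L lborel (A 0) = l"
    using integral_monotone_convergence_nonneg[OF A_int _ _ A_lim l A0_meas] A_mono A_nonneg
    by (auto simp: mono_def)
  have "?lhs = (LINT x|lborel. A 0 x + B x)"
    by (simp add: A_def B_def C_def s_def algebra_simps)
  also have "\<dots> = l + integral\<^sup>L lborel B"
    using A0 B_int by simp
  also have "\<dots> \<le> ?rhs"
    using LIMSEQ_le_const2[OF l] A_bound by fastforce
  finally show ?thesis .
qed

section \<open>Functions on an open set\<close>

text \<open>The open sets \<open>\<Omega>\<close> and \<open>- K\<close> cover the whole space, and the extension is \<open>u\<close> on the first and
  \<open>0\<close> on the second.\<close>

lemma extend_by_zero_C1:
  fixes u :: "'a::euclidean_space \<Rightarrow> 'b::real_normed_vector"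
  assumes "open \<Omega>" and C1: "Ck_on 1 u \<Omega>" and "closed K" and "K \<subseteq> \<Omega>"
    and supp: "\<And>x. x \<in> \<Omega> - K \<Longrightarrow> u x = 0"
  defines "u' \<equiv> \<lambda>x v. if x \<in> \<Omega> then frechet_derivative u (at x) v else 0"
  shows "((\<lambda>x. if x \<in> \<Omega> then u x else 0) has_derivative u' x) (at x)" (is "(?U has_derivative _) _")
    and "continuous_on UNIV (\<lambda>x. u' x v)"
proof -
  have dU: "(?U has_derivative frechet_derivative u (at x)) (at x)" if "x \<in> \<Omega>" for x
  proof (rule has_derivative_transform_within_open[OF _ \<open>open \<Omega>\<close> that])
    show "(u has_derivative frechet_derivative u (at x)) (at x)"
      using C1 that by (simp add: frechet_derivative_works[symmetric])
  qed simp
  have d0: "(?U has_derivative (\<lambda>v. 0)) (at x)" if "x \<notin> K" for x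
    using that supp \<open>closed K\<close>
    by (intro has_derivative_transform_within_open[OF has_derivative_const[of 0 "at x"], of "- K"]) auto
  show "(?U has_derivative u' x) (at x)"
    using dU[of x] d0[of x] \<open>K \<subseteq> \<Omega>\<close> by (cases "x \<in> \<Omega>") (auto simp: u'_def)
  have zero: "u' x v = 0" if "x \<notin> K" for x
    using has_derivative_unique[OF dU d0[OF that]] by (auto simp: u'_def fun_eq_iff)
  have "continuous_on (\<Omega> \<union> - K) (\<lambda>x. u' x v)"
  proof (rule continuous_on_open_Un)
    show "continuous_on \<Omega> (\<lambda>x. u' x v)"
      using C1 by (simp add: u'_def cong: continuous_on_cong)
    show "continuous_on (- K) (\<lambda>x. u' x v)"
      using continuous_on_cong[of "- K" "- K" "\<lambda>x. u' x v" "\<lambda>x. 0"] zero by simp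
  qed (use \<open>open \<Omega>\<close> \<open>closed K\<close> in auto)
  also have "\<Omega> \<union> - K = UNIV"
    using \<open>K \<subseteq> \<Omega>\<close> by auto
  finally show "continuous_on UNIV (\<lambda>x. u' x v)" .
qed

text \<open>It remains to apply \<open>gaussian_hardy\<close> to the extension of \<open>u\<close> by zero, whose derivative also
  vanishes outside \<open>\<Omega>\<close>, so that integrals over the whole space are integrals over \<open>\<Omega>\<close>.\<close>

theorem theorem6p1:
  fixes mul :: "real ^ 'n \<Rightarrow> real ^ 'n \<Rightarrow> real ^ 'n"
    and ginv :: "real ^ 'n \<Rightarrow> real ^ 'n"
    and \<sigma> :: "'n::finite \<Rightarrow> nat"
    and r N :: nat
    and \<Omega> K :: "(real ^ 'n) set"
    and x0 :: "real ^ 'n"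
    and u :: "real ^ 'n \<Rightarrow> complex"
    and lam :: real
  assumes "stratified_group mul ginv \<sigma> r"
    and "N = card (stratum \<sigma> 1)" and "N \<ge> 3"
    and "open \<Omega>" and "x0 \<in> \<Omega>"
    and "Ck_on 1 u \<Omega>"
    and "compact K" and "K \<subseteq> \<Omega>" and "\<And>x. x \<in> \<Omega> - K \<Longrightarrow> u x = 0"
    and "lam > 0"
  shows "(LINT x:\<Omega>|lborel. exp (- (norm1 \<sigma> (mul x (ginv x0)))\<^sup>2 / (4 * lam)) *
            ((real N - 2)\<^sup>2 / (4 * (norm1 \<sigma> x)\<^sup>2) - real N / (4 * lam)
              + (norm1 \<sigma> (mul x (ginv x0)))\<^sup>2 / (16 * lam\<^sup>2)) * (cmod (u x))\<^sup>2)
         \<le> (LINT x:\<Omega>|lborel. exp (- (norm1 \<sigma> (mul x (ginv x0)))\<^sup>2 / (4 * lam)) *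
            (norm_hgrad mul \<sigma> u x)\<^sup>2)"
proof -
  interpret stratified_group mul ginv \<sigma> r by (rule assms)
  let ?S = "stratum \<sigma> 1"
  define U where "U x = (if x \<in> \<Omega> then u x else 0)" for x
  define U' where "U' x v = (if x \<in> \<Omega> then frechet_derivative u (at x) v else 0)" for x v
  have dU: "(U has_derivative U' x) (at x)" and U'_cont: "continuous_on UNIV (\<lambda>x. U' x v)" for x v
    using extend_by_zero_C1[OF \<open>open \<Omega>\<close> \<open>Ck_on 1 u \<Omega>\<close> compact_imp_closed[OF \<open>compact K\<close>] \<open>K \<subseteq> \<Omega>\<close> assms(9)]
    by (simp_all add: U_def[abs_def] U'_def[abs_def])
  have U_supp: "U x = 0" if "x \<notin> K" for x
    using that assms(9) by (simp add: U_def)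
  have n1: "(norm1 \<sigma> x)\<^sup>2 = (\<Sum>i\<in>?S. (x $ i)\<^sup>2)" for x
    by (simp add: norm1_def L2_set_def sum_nonneg)
  have hg: "(norm_hgrad mul \<sigma> u x)\<^sup>2 = (\<Sum>k\<in>?S. (norm (U' x (jacobian_generator mul k x)))\<^sup>2)" if "x \<in> \<Omega>" for x
    using that by (simp add: norm_hgrad_def L2_set_def sum_nonneg vf_apply_def U'_def)
  have "card ?S \<ge> 2"
    using assms(2,3) by simp
  note main = gaussian_hardy[OF dU U'_cont \<open>compact K\<close> U_supp this \<open>lam > 0\<close>, of x0]
  show ?thesis
    unfolding set_lebesgue_integral_def norm1_mul_ginv assms(2)
    unfolding n1
  proof (rule order.trans[OF order.trans[OF eq_refl main] eq_refl])
  qed (auto intro!: Bochner_Integration.integral_cong simp: U_def hg U'_def indicator_def)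
qed

end
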